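(* (1) There is no algorithm that, given an arbitrary constructive linear programming problem (CLPP) whose set of allowable plans is nonempty and bounded, computes an optimal plan of it. (2) There is no algorithm that, given an arbitrary CLPP whose set of allowable plans is nonempty and bounded, computes the extremal value of its cost function.
   Context: "Algorithm" means Turing machine (partial recursive function); algorithms are encoded by natural numbers, and an algorithm applied to other algorithms receives their codes. A constructive real number (CRN) is a pair of algorithms $(F,R)$, where $F$ transforms every natural number into a rational number, $R$ transforms every positive rational number into a natural number, and for every rational $\varepsilon>0$ and all $m,n>R(\varepsilon)$ one has $|F(m)-F(n)|<\varepsilon$. If $x=(F,R)$, write $x(n)=F(n)$. For CRNs $x,y$: $x=y$ means that for every rational $\varepsilon>0$ one can algorithmically produce a natural $M$ such that $|x(m)-y(n)|<\varepsilon$ for all $m,n>M$; $x<y$ means that one can produce a rational $\varepsilon>0$ and a natural $M$ such that $y(m)>x(n)+\varepsilon$ for all $m,n>M$; $x\le y$ means that for every rational $\varepsilon>0$ one can algorithmically produce a natural $M$ such that $y(m)>x(n)-\varepsilon$ for all $m,n>M$. Arithmetic operations on CRNs are the natural ones. An algorithm receiving a CRN as input receives the codes of the pair $(F,R)$, and an algorithm computing a CRN outputs the codes of such a pair; algorithms on CRNs are not required to give equal results for equal CRNs. A constructive linear programming problem (CLPP) is a problem of maximizing or minimizing a linear function (the cost function) of finitely many variables subject to finitely many linear equations and nonstrict linear inequalities, all of whose coefficients and constants are CRNs; it is given by (the codes of) these CRNs. A plan is a tuple of CRNs, one for each variable. A plan is allowable if it satisfies all the constraints. An allowable plan is optimal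 if the cost function attains at it its maximum (respectively minimum) over all allowable plans; this value of the cost function is the extremal value. The set of allowable plans is nonempty if it is impossible that no allowable plan exists (no procedure for finding one is supplied as input), and it is bounded if there is a rational number bounding the absolute values of all coordinates of all allowable plans. *)

theory Defs
  imports Complex_Main "HOL-Library.Nat_Bijection"
begin

text \<open>
  Algorithms are programs for the partial recursive functions in unary form: tuples are packed into
  a single natural number with the Cantor pairing \<^const>\<open>prod_encode\<close>. The programs are generated
  from zero, successor, the two projections and pairing by composition, primitive recursion and
  unbounded minimisation.
\<close>

datatype algorithm =
    Zero
  | Succ
  | Fst
  | Snd
  | Tup algorithm algorithm
  | Comp algorithm algorithm
  | Prec algorithm algorithm
  | Mu algorithm

text \<open>
  \<open>computes f x y\<close>: the algorithm \<open>f\<close> halts on input \<open>x\<close> with output \<open>y\<close>.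
\<close>

inductive computes :: "algorithm \<Rightarrow> nat \<Rightarrow> nat \<Rightarrow> bool" where
  computes_Zero: "computes Zero x 0"
| computes_Succ: "computes Succ x (Suc x)"
| computes_Fst: "computes Fst x (fst (prod_decode x))"
| computes_Snd: "computes Snd x (snd (prod_decode x))"
| computes_Tup: "computes f x y \<Longrightarrow> computes g x z \<Longrightarrow> computes (Tup f g) x (prod_encode (y, z))"
| computes_Comp: "computes g x y \<Longrightarrow> computes f y z \<Longrightarrow> computes (Comp f g) x z"
| computes_Prec_0: "computes f a y \<Longrightarrow> computes (Prec f g) (prod_encode (a, 0)) y"
| computes_Prec_Suc:
    "computes (Prec f g) (prod_encode (a, n)) i \<Longrightarrow>
     computes g (prod_encode (a, prod_encode (n, i))) y \<Longrightarrow>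
     computes (Prec f g) (prod_encode (a, Suc n)) y"
| computes_Mu:
    "computes f (prod_encode (x, n)) 0 \<Longrightarrow>
     (\<forall>m<n. \<exists>k. computes f (prod_encode (x, m)) (Suc k)) \<Longrightarrow>
     computes (Mu f) x n"

lemma computes_deterministic: "computes f x y \<Longrightarrow> computes f x z \<Longrightarrow> y = z"
proof (induction arbitrary: z rule: computes.induct)
  case (computes_Tup f x y g z')
  from computes_Tup.prems computes_Tup.IH show ?case
    by (cases rule: computes.cases) blast+
next
  case (computes_Comp g x y f z')
  from computes_Comp.prems computes_Comp.IH show ?case
    by (cases rule: computes.cases) blast+
next
  case (computes_Prec_0 f a y g)
  from computes_Prec_0.prems computes_Prec_0.IH show ?case
    by (cases rule: computes.cases) auto
next
  case (computes_Prec_Suc f g a n i y)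
  from computes_Prec_Suc.prems show ?case
    by (cases rule: computes.cases) (use computes_Prec_Suc.IH in auto)
next
  case (computes_Mu f x n)
  from computes_Mu.prems show ?case
  proof (cases rule: computes.cases)
    case computes_Mu': computes_Mu
    show ?thesis
    proof (rule linorder_cases[of n z])
      assume "n < z"
      then obtain k where "computes f (prod_encode (x, n)) (Suc k)"
        using computes_Mu' by blast
      with computes_Mu.IH(1) show ?thesis by blast
    next
      assume "z < n"
      then obtain k where "\<forall>w. computes f (prod_encode (x, z)) w \<longrightarrow> Suc k = w"
        using computes_Mu.IH(2) by blast
      with computes_Mu' show ?thesis by blast
    qed simp
  qed
qed (erule computes.cases; simp)+

fun algorithm_encode :: "algorithm \<Rightarrow> nat" where
  "algorithm_encode Zero = prod_encode (0, 0)"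
| "algorithm_encode Succ = prod_encode (1, 0)"
| "algorithm_encode Fst = prod_encode (2, 0)"
| "algorithm_encode Snd = prod_encode (3, 0)"
| "algorithm_encode (Tup f g) =
     prod_encode (4, prod_encode (algorithm_encode f, algorithm_encode g))"
| "algorithm_encode (Comp f g) =
     prod_encode (5, prod_encode (algorithm_encode f, algorithm_encode g))"
| "algorithm_encode (Prec f g) =
     prod_encode (6, prod_encode (algorithm_encode f, algorithm_encode g))"
| "algorithm_encode (Mu f) = prod_encode (7, algorithm_encode f)"

lemma algorithm_encode_inject: "algorithm_encode f = algorithm_encode g \<Longrightarrow> f = g"
  by (induction f arbitrary: g; case_tac g) auto

text \<open>
  A rational number is presented to an algorithm, and returned by it, as the pair of the numerator
  and the positive denominator of its reduced fraction.
\<close>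

definition rat_encode :: "rat \<Rightarrow> nat" where
  "rat_encode q =
     prod_encode (int_encode (fst (quotient_of q)), nat (snd (quotient_of q)))"

lemma rat_encode_inject: "rat_encode p = rat_encode q \<Longrightarrow> p = q"
  using quotient_of_denom_pos'[of p] quotient_of_denom_pos'[of q]
  by (auto simp: rat_encode_def quotient_of_inject_eq[symmetric] prod_eq_iff
      dest: injD[OF inj_int_encode])

text \<open>
  A constructive real number is a pair \<open>(F, R)\<close> of algorithms. The value \<open>crn_seq x n\<close> is
  meaningful only if \<open>F\<close> halts on \<open>n\<close> with a rational output, which \<open>is_crn\<close> demands for all \<open>n\<close>.
\<close>

type_synonym crn = "algorithm \<times> algorithm"

definition crn_seq :: "crn \<Rightarrow> nat \<Rightarrow> rat" where
  "crn_seq x n = (THE q. computes (fst x) n (rat_encode q))"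

definition is_crn :: "crn \<Rightarrow> bool" where
  "is_crn x \<longleftrightarrow>
     (\<forall>n. \<exists>q. computes (fst x) n (rat_encode q)) \<and>
     (\<forall>\<epsilon>>0. \<exists>N. computes (snd x) (rat_encode \<epsilon>) N \<and>
        (\<forall>m>N. \<forall>n>N. \<bar>crn_seq x m - crn_seq x n\<bar> < \<epsilon>))"

definition crn_encode :: "crn \<Rightarrow> nat" where
  "crn_encode x = prod_encode (algorithm_encode (fst x), algorithm_encode (snd x))"

text \<open>
  Equality and order of constructive reals refer only to their sequences of rational approximations,
  and the arithmetic operations act termwise on these sequences. The relations are therefore defined
  on sequences, so that they apply to \<^term>\<open>crn_seq x\<close> as well as to termwise sums and products. The
  algorithm \<open>M\<close> produces the required bound from \<open>\<epsilon>\<close>.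
\<close>

definition seq_eq :: "(nat \<Rightarrow> rat) \<Rightarrow> (nat \<Rightarrow> rat) \<Rightarrow> bool" where
  "seq_eq x y \<longleftrightarrow>
     (\<exists>M. \<forall>\<epsilon>>0. \<exists>N. computes M (rat_encode \<epsilon>) N \<and>
        (\<forall>m>N. \<forall>n>N. \<bar>x m - y n\<bar> < \<epsilon>))"

definition seq_le :: "(nat \<Rightarrow> rat) \<Rightarrow> (nat \<Rightarrow> rat) \<Rightarrow> bool" where
  "seq_le x y \<longleftrightarrow>
     (\<exists>M. \<forall>\<epsilon>>0. \<exists>N. computes M (rat_encode \<epsilon>) N \<and>
        (\<forall>m>N. \<forall>n>N. y m > x n - \<epsilon>))"

definition linear_form :: "crn list \<Rightarrow> crn list \<Rightarrow> nat \<Rightarrow> rat" where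
  "linear_form a x n = (\<Sum>i<length a. crn_seq (a ! i) n * crn_seq (x ! i) n)"

datatype goal = Maximize | Minimize

datatype comparison = EQ | LE | GE

text \<open>
  \<open>Constraint a c b\<close> stands for \<open>a \<bullet> x = b\<close>, \<open>a \<bullet> x \<le> b\<close> or \<open>a \<bullet> x \<ge> b\<close>, according to \<open>c\<close>.
  In a problem, the number of variables is the length of the list of cost coefficients.
\<close>

datatype linear_constraint =
  Constraint (coeffs: "crn list") (comparison: comparison) (rhs: crn)

datatype clpp =
  CLPP (goal: goal) (cost: "crn list") (constraints: "linear_constraint list")

definition is_clpp :: "clpp \<Rightarrow> bool" where
  "is_clpp P \<longleftrightarrow>
     (\<forall>a\<in>set (cost P). is_crn a) \<and>
     (\<forall>c\<in>set (constraints P).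
        length (coeffs c) = length (cost P) \<and> (\<forall>a\<in>set (coeffs c). is_crn a) \<and> is_crn (rhs c))"

definition is_plan :: "clpp \<Rightarrow> crn list \<Rightarrow> bool" where
  "is_plan P x \<longleftrightarrow> length x = length (cost P) \<and> (\<forall>a\<in>set x. is_crn a)"

fun satisfies :: "crn list \<Rightarrow> linear_constraint \<Rightarrow> bool" where
  "satisfies x (Constraint a EQ b) = seq_eq (linear_form a x) (crn_seq b)"
| "satisfies x (Constraint a LE b) = seq_le (linear_form a x) (crn_seq b)"
| "satisfies x (Constraint a GE b) = seq_le (crn_seq b) (linear_form a x)"

definition allowable :: "clpp \<Rightarrow> crn list \<Rightarrow> bool" where
  "allowable P x \<longleftrightarrow> is_plan P x \<and> (\<forall>c\<in>set (constraints P). satisfies x c)"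

definition nonempty_clpp :: "clpp \<Rightarrow> bool" where
  "nonempty_clpp P \<longleftrightarrow> \<not> (\<forall>x. \<not> allowable P x)"

definition bounded_clpp :: "clpp \<Rightarrow> bool" where
  "bounded_clpp P \<longleftrightarrow>
     (\<exists>B::rat. \<forall>x. allowable P x \<longrightarrow>
        (\<forall>a\<in>set x. seq_le (\<lambda>n. \<bar>crn_seq a n\<bar>) (\<lambda>n. B)))"

definition optimal :: "clpp \<Rightarrow> crn list \<Rightarrow> bool" where
  "optimal P x \<longleftrightarrow> allowable P x \<and>
     (\<forall>y. allowable P y \<longrightarrow>
        (case goal P of
           Maximize \<Rightarrow> seq_le (linear_form (cost P) y) (linear_form (cost P) x)
         | Minimize \<Rightarrow> seq_le (linear_form (cost P) x) (linear_form (cost P) y)))"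

definition extremal_value :: "clpp \<Rightarrow> crn \<Rightarrow> bool" where
  "extremal_value P v \<longleftrightarrow> is_crn v \<and>
     (\<exists>x. optimal P x \<and> seq_eq (crn_seq v) (linear_form (cost P) x))"

fun goal_encode :: "goal \<Rightarrow> nat" where
  "goal_encode Maximize = 0"
| "goal_encode Minimize = 1"

fun comparison_encode :: "comparison \<Rightarrow> nat" where
  "comparison_encode EQ = 0"
| "comparison_encode LE = 1"
| "comparison_encode GE = 2"

definition crns_encode :: "crn list \<Rightarrow> nat" where
  "crns_encode x = list_encode (map crn_encode x)"

definition constraint_encode :: "linear_constraint \<Rightarrow> nat" where
  "constraint_encode c =
     prod_encode (crns_encode (coeffs c),
       prod_encode (comparison_encode (comparison c), crn_encode (rhs c)))"

definition clpp_encode :: "clpp \<Rightarrow> nat" where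
  "clpp_encode P =
     prod_encode (goal_encode (goal P),
       prod_encode (crns_encode (cost P), list_encode (map constraint_encode (constraints P))))"

end

theory Submission
  imports Defs
begin

text \<open>
  For a constructive real \<open>a\<close>, the problem of maximizing \<open>x\<close> subject to \<open>a x = 0\<close> and
  \<open>0 \<le> x \<le> 1\<close> has the extremal value \<open>1\<close> if \<open>a = 0\<close> and \<open>0\<close> otherwise. Given an algorithm \<open>A\<close>
  that is claimed to compute this value, the recursion theorem provides an \<open>a\<close> that knows its own
  code: its sequence simulates \<open>A\<close> on the problem of \<open>a\<close>, evaluates the resulting constructive
  real to precision \<open>1/4\<close>, and stays \<open>0\<close> unless the simulation halts, after some number \<open>t\<close> of
  steps, with an approximation above \<open>1/2\<close>; in this case it becomes \<open>1/t\<close>.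
\<close>

section \<open>Computable functions\<close>

abbreviation pair :: "nat \<Rightarrow> nat \<Rightarrow> nat" where "pair x y \<equiv> prod_encode (x, y)"
abbreviation left :: "nat \<Rightarrow> nat" where "left x \<equiv> fst (prod_decode x)"
abbreviation right :: "nat \<Rightarrow> nat" where "right x \<equiv> snd (prod_decode x)"

definition computable :: "(nat \<Rightarrow> nat) \<Rightarrow> bool" where
  "computable f \<longleftrightarrow> (\<exists>p. \<forall>x. computes p x (f x))"

text \<open>Truth is coded by 0, so that a primitive recursion on the code takes its base case
  exactly when the predicate holds.\<close>

definition decidable :: "(nat \<Rightarrow> bool) \<Rightarrow> bool" where
  "decidable P \<longleftrightarrow> computable (\<lambda>x. if P x then 0 else 1)"

named_theorems computable_intros

fun const_algorithm :: "nat \<Rightarrow> algorithm" where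
  "const_algorithm 0 = Zero"
| "const_algorithm (Suc n) = Comp Succ (const_algorithm n)"

lemma computes_constant: "computes (const_algorithm c) x c"
  by (induction c) (auto intro: computes.intros)

lemma computes_identity: "computes (Tup Fst Snd) x x"
  using computes_Tup[OF computes_Fst computes_Snd, of x] by simp

lemma computable_const [computable_intros]: "computable (\<lambda>x. c)"
  unfolding computable_def using computes_constant by blast

lemma computable_id [computable_intros]: "computable (\<lambda>x. x)"
  unfolding computable_def using computes_identity by blast

lemma computable_comp: "computable f \<Longrightarrow> computable g \<Longrightarrow> computable (\<lambda>x. f (g x))"
  unfolding computable_def by (meson computes_Comp)

lemma computable_Suc [computable_intros]: "computable f \<Longrightarrow> computable (\<lambda>x. Suc (f x))"
  unfolding computable_def by (meson computes_Comp computes_Succ)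

lemma computable_left [computable_intros]: "computable f \<Longrightarrow> computable (\<lambda>x. left (f x))"
  unfolding computable_def by (meson computes_Comp computes_Fst)

lemma computable_right [computable_intros]: "computable f \<Longrightarrow> computable (\<lambda>x. right (f x))"
  unfolding computable_def by (meson computes_Comp computes_Snd)

lemma computable_pair [computable_intros]:
  "computable f \<Longrightarrow> computable g \<Longrightarrow> computable (\<lambda>x. pair (f x) (g x))"
  unfolding computable_def by (meson computes_Tup)

text \<open>The nested projections undo the layout in which \<open>Prec\<close> hands parameter,
  counter and previous result to its step. Including \<open>a\<close> and \<open>n\<close> builds
  substitution in, which spares a separate composition in each application.\<close>

lemma computable_rec:
  assumes "computable f"
    and "computable (\<lambda>z. g (left z) (left (right z)) (right (right z)))"
    and "computable a" and "computable n"
  shows "computable (\<lambda>x. rec_nat (f (a x)) (g (a x)) (n x))"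
proof -
  obtain p q where p: "\<And>x. computes p x (f x)"
    and q: "\<And>z. computes q z (g (left z) (left (right z)) (right (right z)))"
    using assms(1,2) unfolding computable_def by blast
  have "computes (Prec p q) (pair x m) (rec_nat (f x) (g x) m)" for x m
  proof (induction m)
    case 0
    show ?case using computes_Prec_0[OF p] by simp
  next
    case (Suc m)
    show ?case
      using computes_Prec_Suc[OF Suc q] by simp
  qed
  then have "computes (Prec p q) z (rec_nat (f (left z)) (g (left z)) (right z))" for z
    by (metis prod.collapse prod_decode_inverse)
  then have "computable (\<lambda>z. rec_nat (f (left z)) (g (left z)) (right z))"
    unfolding computable_def by blast
  from computable_comp[OF this computable_pair[OF assms(3,4)]] show ?thesis by simp
qed

text \<open>A recursion of length 0 or 1 selects the branch. In the else case the base value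
  \<open>f x\<close> is computed as well, which is harmless because \<open>f\<close> is
  total.\<close>

lemma computable_if [computable_intros]:
  assumes "decidable P" and "computable f" and "computable g"
  shows "computable (\<lambda>x. if P x then f x else g x)"
proof -
  have "computable (\<lambda>x. rec_nat (f x) (\<lambda>_ _. g x) (if P x then 0 else 1))"
    by (rule computable_rec[where g = "\<lambda>x _ _. g x" and a = "\<lambda>x. x"])
      (use assms in \<open>simp_all add: decidable_def computable_intros computable_comp[of g left]\<close>)
  moreover have "rec_nat (f x) (\<lambda>_ _. g x) (if P x then 0 else 1) = (if P x then f x else g x)" for x
    by simp
  ultimately show ?thesis by simp
qed

lemma computable_pred [computable_intros]:
  assumes "computable f"
  shows "computable (\<lambda>x. f x - 1)"
proof -
  have "computable (\<lambda>x. rec_nat 0 (\<lambda>n _. n) (f x))"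
    by (rule computable_rec[where f = "\<lambda>_. 0" and g = "\<lambda>_ n _. n" and a = "\<lambda>x. x"])
      (intro computable_intros assms)+
  moreover have "rec_nat 0 (\<lambda>n _. n) m = m - 1" for m :: nat
    by (cases m) auto
  ultimately show ?thesis by simp
qed

lemma computable_diff [computable_intros]:
  assumes "computable f" and "computable g"
  shows "computable (\<lambda>x. f x - g x)"
proof -
  have "computable (\<lambda>x. rec_nat (f x) (\<lambda>_ r. r - 1) (g x))"
    by (rule computable_rec[where g = "\<lambda>_ _ r. r - 1" and a = "\<lambda>x. x"])
      (intro computable_intros assms)+
  moreover have "rec_nat k (\<lambda>_ r. r - 1) m = k - m" for k m :: nat
    by (induction m) auto
  ultimately show ?thesis by simp
qed

lemma decidable_less [computable_intros]:
  assumes "computable f" and "computable g"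
  shows "decidable (\<lambda>x. f x < g x)"
proof -
  have "computable (\<lambda>x. 1 - (g x - f x))"
    by (intro computable_intros assms)
  moreover have "1 - (m - n) = (if n < m then 0 else 1)" for m n :: nat by simp
  ultimately show ?thesis by (simp add: decidable_def)
qed

lemma decidable_not [computable_intros]:
  assumes "decidable P"
  shows "decidable (\<lambda>x. \<not> P x)"
proof -
  have "computable (\<lambda>x. if P x then 1 else 0)"
    by (intro computable_intros assms)
  then show ?thesis
    unfolding decidable_def by (rule back_subst[of computable]) auto
qed

lemma decidable_conj [computable_intros]:
  assumes "decidable P" and "decidable Q"
  shows "decidable (\<lambda>x. P x \<and> Q x)"
proof -
  have "computable (\<lambda>x. if P x then if Q x then 0 else 1 else 1)"
    by (intro computable_intros assms)
  then show ?thesis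
    unfolding decidable_def by (rule back_subst[of computable]) auto
qed

lemma decidable_eq [computable_intros]:
  assumes "computable f" and "computable g"
  shows "decidable (\<lambda>x. f x = g x)"
proof -
  have "decidable (\<lambda>x. \<not> f x < g x \<and> \<not> g x < f x)"
    by (intro computable_intros assms)
  then show ?thesis
    by (rule back_subst[of decidable]) auto
qed

text \<open>With \<open>n\<close> as a clock, this makes bounded simulation of a machine a total
  computable function.\<close>

lemma computable_funpow:
  assumes "computable h" and "computable f" and "computable n"
  shows "computable (\<lambda>x. (h ^^ n x) (f x))"
proof -
  have "computable (\<lambda>x. rec_nat (f x) (\<lambda>_. h) (n x))"
    by (rule computable_rec[where g = "\<lambda>_ _ r. h r" and a = "\<lambda>x. x"])
      (intro computable_intros assms computable_comp[OF assms(1)])+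
  moreover have "rec_nat y (\<lambda>_. h) m = (h ^^ m) y" for y m
    by (induction m) auto
  ultimately show ?thesis by simp
qed

section \<open>The recursion theorem\<close>

lemma computable_encode_constant: "computable (\<lambda>c. algorithm_encode (const_algorithm c))"
proof -
  have "computable (\<lambda>c. rec_nat (pair 0 0) (\<lambda>_ r. pair 5 (pair (pair 1 0) r)) c)"
    by (rule computable_rec[where f = "\<lambda>_. pair 0 0" and
          g = "\<lambda>_ _ r. pair 5 (pair (pair 1 0) r)" and a = "\<lambda>x. x"])
      (intro computable_intros)+
  moreover have "rec_nat (pair 0 0) (\<lambda>_ r. pair 5 (pair (pair 1 0) r)) c
      = algorithm_encode (const_algorithm c)" for c
    by (induction c) auto
  ultimately show ?thesis by simp
qed

lemma recursion_theorem:
  assumes "computable h"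
  obtains F where "\<And>n. computes F n (h (pair (algorithm_encode F) n))"
proof -
  \<comment> \<open>If \<open>c\<close> is the code of \<open>G\<close>, then \<open>self c\<close>
    is the code of \<open>G\<close> with \<open>c\<close> hardwired as the first component of its
    input.\<close>
  define self where "self c = pair 5 (pair c (pair 4 (pair (algorithm_encode (const_algorithm c))
    (algorithm_encode (Tup Fst Snd)))))" for c
  have self: "computable self"
    unfolding self_def by (intro computable_intros computable_encode_constant)
  then have "computable (\<lambda>z. h (pair (self (left z)) (right z)))"
    by (intro computable_comp[OF assms] computable_intros computable_comp[OF self])
  then obtain G where G: "\<And>z. computes G z (h (pair (self (left z)) (right z)))"
    unfolding computable_def by blast
  \<comment> \<open>\<open>G\<close> receives its own code, from which \<open>self\<close>
    reconstructs the code of the whole program \<open>F\<close>.\<close>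
  define F where "F = Comp G (Tup (const_algorithm (algorithm_encode G)) (Tup Fst Snd))"
  have "algorithm_encode F = self (algorithm_encode G)"
    by (simp add: F_def self_def)
  moreover have "computes F n (h (pair (self (algorithm_encode G)) n))" for n
    unfolding F_def using computes_Comp[OF computes_Tup[OF computes_constant computes_identity] G]
    by simp
  ultimately show ?thesis using that[of F] by simp
qed

section \<open>A universal machine\<close>

text \<open>
  A state \<open>pair v (pair c k)\<close> consists of a value \<open>v\<close>, the instruction \<open>c\<close> to be applied to it, and
  the remaining instructions \<open>k\<close>. The instructions with tags up to \<open>7\<close> are the codes of algorithms.
  Those with tags \<open>8\<close>, \<open>9\<close> and \<open>10\<close> hold intermediate results of \<^const>\<open>Tup\<close>, \<^const>\<open>Prec\<close> and
  \<^const>\<open>Mu\<close>, tag \<open>11\<close> applies the algorithm with code \<open>left v\<close> to \<open>right v\<close>, and all further tags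
  halt.
\<close>

definition step :: "nat \<Rightarrow> nat" where
  "step s =
    (let v = left s; c = left (right s); k = right (right s); t = left c; d = right c in
     if t = 0 then pair 0 k
     else if t = 1 then pair (Suc v) k
     else if t = 2 then pair (left v) k
     else if t = 3 then pair (right v) k
     else if t = 4 then pair v (pair (left d) (pair (pair 8 (pair (right d) v)) k))
     else if t = 5 then pair v (pair (right d) (pair (left d) k))
     else if t = 6 then
       if right v = 0 then pair (left v) (pair (left d) k)
       else pair (pair (left v) (right v - 1))
         (pair c (pair (pair 9 (right v - 1)) (pair (pair 9 (left v)) (pair (right d) k))))
     else if t = 7 then pair (pair v 0) (pair d (pair (pair 10 (pair d (pair v 0))) k))
     else if t = 8 then pair (right d) (pair (left d) (pair (pair 9 v) k))
     else if t = 9 then pair (pair d v) k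
     else if t = 10 then
       if v = 0 then pair (right (right d)) k
       else pair (pair (left (right d)) (Suc (right (right d)))) (pair (left d)
         (pair (pair 10 (pair (left d) (pair (left (right d)) (Suc (right (right d)))))) k))
     else if t = 11 then pair (right v) (pair (left v) k)
     else s)"

lemma computable_step: "computable step"
  unfolding step_def Let_def by (intro computable_intros)

definition reaches :: "nat \<Rightarrow> nat \<Rightarrow> bool" where
  "reaches s s' \<longleftrightarrow> (\<exists>n. (step ^^ n) s = s')"

lemma reaches_trans [trans]: "reaches s s' \<Longrightarrow> reaches s' s'' \<Longrightarrow> reaches s s''"
  unfolding reaches_def by (metis add.commute comp_apply funpow_add)

lemma reaches_step: "step s = s' \<Longrightarrow> reaches s s'"
  unfolding reaches_def by (rule exI[of _ 1]) simp

text \<open>Quantifying over the remaining instructions \<open>k\<close> makes runs compose: a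
  subprogram leaves whatever is stacked below it untouched.\<close>

definition runs :: "nat \<Rightarrow> nat \<Rightarrow> nat \<Rightarrow> bool" where
  "runs c x y \<longleftrightarrow> (\<forall>k. reaches (pair x (pair c k)) (pair y k))"

lemma runs_step: "(\<And>k. step (pair x (pair c k)) = pair y k) \<Longrightarrow> runs c x y"
  by (simp add: runs_def reaches_step)

lemma reaches_runs: "reaches s (pair x (pair c k)) \<Longrightarrow> runs c x y \<Longrightarrow> reaches s (pair y k)"
  unfolding runs_def using reaches_trans by blast

lemma runs_Tup:
  assumes "runs f x y" and "runs g x z"
  shows "runs (pair 4 (pair f g)) x (pair y z)"
  unfolding runs_def
proof
  fix k
  let ?s = "pair x (pair (pair 4 (pair f g)) k)"
  have "reaches ?s (pair x (pair f (pair (pair 8 (pair g x)) k)))"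
    by (rule reaches_step) (simp add: step_def)
  from reaches_runs[OF this assms(1)]
  have "reaches ?s (pair y (pair (pair 8 (pair g x)) k))" .
  also have "reaches \<dots> (pair x (pair g (pair (pair 9 y) k)))"
    by (rule reaches_step) (simp add: step_def)
  finally have "reaches ?s (pair x (pair g (pair (pair 9 y) k)))" .
  from reaches_runs[OF this assms(2)] have "reaches ?s (pair z (pair (pair 9 y) k))" .
  also have "reaches \<dots> (pair (pair y z) k)"
    by (rule reaches_step) (simp add: step_def)
  finally show "reaches ?s (pair (pair y z) k)" .
qed

lemma runs_Comp:
  assumes "runs g x y" and "runs f y z"
  shows "runs (pair 5 (pair f g)) x z"
  unfolding runs_def
proof
  fix k
  have "reaches (pair x (pair (pair 5 (pair f g)) k)) (pair x (pair g (pair f k)))"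
    by (rule reaches_step) (simp add: step_def)
  then show "reaches (pair x (pair (pair 5 (pair f g)) k)) (pair z k)"
    using assms reaches_runs by blast
qed

lemma runs_apply:
  assumes "runs c x y"
  shows "runs (pair 11 0) (pair c x) y"
  unfolding runs_def
proof
  fix k
  have "reaches (pair (pair c x) (pair (pair 11 0) k)) (pair x (pair c k))"
    by (rule reaches_step) (simp add: step_def)
  then show "reaches (pair (pair c x) (pair (pair 11 0) k)) (pair y k)"
    using assms reaches_runs by blast
qed

lemma runs_cons: "runs (pair 9 d) v (pair d v)"
  by (rule runs_step) (simp add: step_def)

text \<open>The frame with tag 10 remembers \<open>f\<close>, \<open>x\<close> and the current
  candidate. A nonzero result makes it restart \<open>f\<close> on the next candidate, with an
  updated frame below.\<close>

lemma reaches_Mu_loop: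
  assumes "\<forall>m<n. \<exists>k. runs f (pair x m) (Suc k)" and "m \<le> n"
  shows "reaches (pair (pair x 0) (pair f (pair (pair 10 (pair f (pair x 0))) k)))
    (pair (pair x m) (pair f (pair (pair 10 (pair f (pair x m))) k)))"
  using assms(2)
proof (induction m)
  case 0
  show ?case unfolding reaches_def by (rule exI[of _ 0]) simp
next
  case (Suc m)
  then obtain r where r: "runs f (pair x m) (Suc r)"
    using assms(1) by force
  have "reaches (pair (Suc r) (pair (pair 10 (pair f (pair x m))) k))
      (pair (pair x (Suc m)) (pair f (pair (pair 10 (pair f (pair x (Suc m)))) k)))"
    by (rule reaches_step) (simp add: step_def)
  then show ?case
    using Suc reaches_runs[OF _ r] reaches_trans by (meson Suc_leD)
qed

text \<open>This makes the machine universal. Each rule of \<open>computes\<close> matches a short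
  run, and induction on the derivation joins these runs.\<close>

lemma computes_runs: "computes f x y \<Longrightarrow> runs (algorithm_encode f) x y"
proof (induction rule: computes.induct)
  case (computes_Prec_0 f a y g)
  show ?case
    unfolding runs_def
  proof
    fix k
    have "reaches (pair (pair a 0) (pair (algorithm_encode (Prec f g)) k))
        (pair a (pair (algorithm_encode f) k))"
      by (rule reaches_step) (simp add: step_def)
    then show "reaches (pair (pair a 0) (pair (algorithm_encode (Prec f g)) k)) (pair y k)"
      using computes_Prec_0.IH reaches_runs by blast
  qed
next
  case (computes_Prec_Suc f g a n i y)
  show ?case
    unfolding runs_def
  proof
    fix k
    let ?c = "algorithm_encode (Prec f g)" and ?g = "algorithm_encode g"
    \<comment> \<open>The two frames with tag 9 wrap the recursive result \<open>i\<close> first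
      into \<open>pair n i\<close> and then into \<open>pair a (pair n i)\<close>, the input
      expected by \<open>g\<close>.\<close>
    have "reaches (pair (pair a (Suc n)) (pair ?c k))
        (pair (pair a n) (pair ?c (pair (pair 9 n) (pair (pair 9 a) (pair ?g k)))))"
      by (rule reaches_step) (simp add: step_def)
    then show "reaches (pair (pair a (Suc n)) (pair ?c k)) (pair y k)"
      using computes_Prec_Suc.IH reaches_runs runs_cons by meson
  qed
next
  case (computes_Mu f x n)
  show ?case
    unfolding runs_def
  proof
    fix k
    let ?f = "algorithm_encode f"
    let ?s = "pair x (pair (algorithm_encode (Mu f)) k)"
    have "reaches ?s (pair (pair x 0) (pair ?f (pair (pair 10 (pair ?f (pair x 0))) k)))"
      by (rule reaches_step) (simp add: step_def Let_def)
    also have "reaches \<dots> (pair (pair x n) (pair ?f (pair (pair 10 (pair ?f (pair x n))) k)))"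
      using computes_Mu.IH(2) by (intro reaches_Mu_loop[where n = n]) blast+
    finally have "reaches ?s (pair (pair x n) (pair ?f (pair (pair 10 (pair ?f (pair x n))) k)))" .
    from reaches_runs[OF this computes_Mu.IH(1)]
    have "reaches ?s (pair 0 (pair (pair 10 (pair ?f (pair x n))) k))" .
    also have "reaches \<dots> (pair n k)"
      by (rule reaches_step) (simp add: step_def)
    finally show "reaches ?s (pair n k)" .
  qed
qed (auto intro: runs_Tup runs_Comp runs_step simp: step_def)

section \<open>Constructive reals and the problem\<close>

lemma crn_seq_eqI: "computes (fst x) n (rat_encode q) \<Longrightarrow> crn_seq x n = q"
  unfolding crn_seq_def
  using computes_deterministic rat_encode_inject by blast

lemma is_crn_computes: "is_crn x \<Longrightarrow> computes (fst x) n (rat_encode (crn_seq x n))"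
  unfolding is_crn_def using crn_seq_eqI by metis

lemma is_crn_modulus:
  assumes "is_crn x" and "\<epsilon> > 0"
  obtains N where "computes (snd x) (rat_encode \<epsilon>) N"
    and "\<And>m n. m > N \<Longrightarrow> n > N \<Longrightarrow> \<bar>crn_seq x m - crn_seq x n\<bar> < \<epsilon>"
  using assms unfolding is_crn_def by blast

definition rat_crn :: "rat \<Rightarrow> crn" where
  "rat_crn q = (const_algorithm (rat_encode q), Zero)"

lemma crn_seq_rat_crn [simp]: "crn_seq (rat_crn q) n = q"
  by (rule crn_seq_eqI) (simp add: rat_crn_def computes_constant)

lemma is_crn_rat_crn [simp]: "is_crn (rat_crn q)"
proof -
  have "computes (fst (rat_crn q)) n (rat_encode q)" "computes (snd (rat_crn q)) n 0" for n
    by (simp_all add: rat_crn_def computes_constant computes_Zero)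
  then show ?thesis unfolding is_crn_def by (metis abs_zero crn_seq_rat_crn diff_self)
qed

lemma seq_eqD: "seq_eq x y \<Longrightarrow> \<epsilon> > 0 \<Longrightarrow> \<exists>N. \<forall>m>N. \<forall>n>N. \<bar>x m - y n\<bar> < \<epsilon>"
  unfolding seq_eq_def by blast

lemma seq_leD: "seq_le x y \<Longrightarrow> \<epsilon> > 0 \<Longrightarrow> \<exists>N. \<forall>m>N. \<forall>n>N. y m > x n - \<epsilon>"
  unfolding seq_le_def by blast

lemma seq_eq_const: "seq_eq (\<lambda>_. c) (\<lambda>_. c)"
  unfolding seq_eq_def by (rule exI[of _ Zero]) (use computes_Zero in fastforce)

lemma seq_le_const: "b \<le> c \<Longrightarrow> seq_le (\<lambda>_. b) (\<lambda>_. c)"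
  unfolding seq_le_def by (rule exI[of _ Zero]) (use computes_Zero in fastforce)

section \<open>The switch problem and its extremal value\<close>

definition switch_clpp :: "crn \<Rightarrow> clpp" where
  "switch_clpp a = CLPP Maximize [rat_crn 1]
     [Constraint [a] EQ (rat_crn 0), Constraint [rat_crn 1] GE (rat_crn 0),
      Constraint [rat_crn 1] LE (rat_crn 1)]"

lemma linear_form_singleton: "linear_form [a] [x] = (\<lambda>n. crn_seq a n * crn_seq x n)"
  by (simp add: linear_form_def fun_eq_iff)

lemma crn_seq_rat_crn_fun: "crn_seq (rat_crn q) = (\<lambda>_. q)"
  by (simp add: fun_eq_iff)

lemma allowable_switch_clpp:
  "allowable (switch_clpp a) y \<longleftrightarrow>
     (\<exists>x. y = [x] \<and> is_crn x \<and> seq_eq (\<lambda>n. crn_seq a n * crn_seq x n) (\<lambda>_. 0) \<and>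
        seq_le (\<lambda>_. 0) (crn_seq x) \<and> seq_le (crn_seq x) (\<lambda>_. 1))"
  by (cases y)
    (auto simp: allowable_def is_plan_def switch_clpp_def linear_form_singleton crn_seq_rat_crn_fun)

lemma is_clpp_switch_clpp: "is_crn a \<Longrightarrow> is_clpp (switch_clpp a)"
  by (simp add: is_clpp_def switch_clpp_def)

lemma nonempty_switch_clpp: "nonempty_clpp (switch_clpp a)"
proof -
  have "allowable (switch_clpp a) [rat_crn 0]"
    by (simp add: allowable_switch_clpp crn_seq_rat_crn_fun seq_eq_const seq_le_const)
  then show ?thesis unfolding nonempty_clpp_def by blast
qed

text \<open>
  With the bound \<open>2\<close> in place of \<open>1\<close>, the modulus of \<open>x\<close> itself witnesses the inequality.
\<close>

lemma bounded_switch_clpp: "bounded_clpp (switch_clpp a)"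
proof -
  have "seq_le (\<lambda>n. \<bar>crn_seq x n\<bar>) (\<lambda>_. 2)"
    if x: "is_crn x" and ge: "seq_le (\<lambda>_. 0) (crn_seq x)" and le: "seq_le (crn_seq x) (\<lambda>_. 1)" for x
    unfolding seq_le_def
  proof (intro exI[of _ "snd x"] allI impI)
    fix \<epsilon> :: rat
    assume "\<epsilon> > 0"
    from is_crn_modulus[OF x this] obtain N where N: "computes (snd x) (rat_encode \<epsilon>) N"
      "\<And>m n. m > N \<Longrightarrow> n > N \<Longrightarrow> \<bar>crn_seq x m - crn_seq x n\<bar> < \<epsilon>" by blast
    obtain N0 where N0: "\<forall>m>N0. crn_seq x m > -1"
      using seq_leD[OF ge, of 1] by auto
    obtain N1 where N1: "\<forall>n>N1. crn_seq x n < 2"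
      using seq_leD[OF le, of 1] by (auto simp: algebra_simps)
    \<comment> \<open>At the late index \<open>l\<close> the term lies between -1 and 2, and the
      modulus carries this over to every index above \<open>N\<close> with error below \<epsilon>.
      Only \<open>N\<close> has to be computed; \<open>l\<close> merely has to exist.\<close>
    define l where "l = Suc (max N (max N0 N1))"
    have "l > N" "crn_seq x l > -1" "crn_seq x l < 2"
      using N0 N1 by (auto simp: l_def less_Suc_eq_le)
    then have "\<bar>crn_seq x n\<bar> - \<epsilon> < 2" if "n > N" for n
      using N(2)[of l n] that by linarith
    then show "\<exists>N. computes (snd x) (rat_encode \<epsilon>) N \<and> (\<forall>m>N. \<forall>n>N. \<bar>crn_seq x n\<bar> - \<epsilon> < 2)"
      using N(1) by blast
  qed
  then show ?thesis
    unfolding bounded_clpp_def allowable_switch_clpp by (intro exI[of _ 2]) auto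
qed

lemma extremal_value_switch_clppE:
  assumes "extremal_value (switch_clpp a) v"
  obtains x where "optimal (switch_clpp a) [x]" and "seq_eq (crn_seq v) (crn_seq x)"
  using assms
  by (auto simp: extremal_value_def optimal_def allowable_switch_clpp linear_form_singleton
      switch_clpp_def[THEN arg_cong[of _ _ cost]])

text \<open>The equation holds for every \<open>x\<close> here, so the plan 1 is allowable and
  forces the optimal value up to at least 1.\<close>

lemma extremal_value_switch_clpp_0:
  assumes a: "\<And>n. crn_seq a n = 0" and "extremal_value (switch_clpp a) v" and "\<epsilon> > 0"
  shows "\<exists>N. \<forall>n>N. crn_seq v n > 1 - \<epsilon>"
proof -
  obtain x where opt: "optimal (switch_clpp a) [x]" and v: "seq_eq (crn_seq v) (crn_seq x)"
    using assms(2) by (rule extremal_value_switch_clppE)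
  have "allowable (switch_clpp a) [rat_crn 1]"
    by (simp add: allowable_switch_clpp crn_seq_rat_crn_fun a seq_eq_const seq_le_const)
  then have "seq_le (\<lambda>_. 1) (crn_seq x)"
    using opt by (auto simp: optimal_def switch_clpp_def linear_form_singleton crn_seq_rat_crn_fun)
  from seq_leD[OF this, of "\<epsilon> / 2"] obtain N where N: "\<forall>m>N. crn_seq x m > 1 - \<epsilon> / 2"
    using \<open>\<epsilon> > 0\<close> by auto
  obtain N' where N': "\<forall>m>N'. \<forall>n>N'. \<bar>crn_seq v m - crn_seq x n\<bar> < \<epsilon> / 2"
    using seq_eqD[OF v, of "\<epsilon> / 2"] \<open>\<epsilon> > 0\<close> by auto
  have "crn_seq v n > 1 - \<epsilon>" if "n > max N N'" for n
  proof -
    have "crn_seq x n > 1 - \<epsilon> / 2" "\<bar>crn_seq v n - crn_seq x n\<bar> < \<epsilon> / 2"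
      using N N' that by auto
    then show ?thesis by linarith
  qed
  then show ?thesis by blast
qed

text \<open>Dividing the equation by the eventual constant \<open>c\<close> forces \<open>x\<close>
  to be 0, and the cost is \<open>x\<close> itself.\<close>

lemma extremal_value_switch_clpp_pos:
  assumes a: "\<And>n. n \<ge> t \<Longrightarrow> crn_seq a n = c" and "c > 0"
    and "extremal_value (switch_clpp a) v" and "\<epsilon> > 0"
  shows "\<exists>N. \<forall>n>N. \<bar>crn_seq v n\<bar> < \<epsilon>"
proof -
  obtain x where opt: "optimal (switch_clpp a) [x]" and v: "seq_eq (crn_seq v) (crn_seq x)"
    using assms(3) by (rule extremal_value_switch_clppE)
  have "seq_eq (\<lambda>n. crn_seq a n * crn_seq x n) (\<lambda>_. 0)"
    using opt by (auto simp: optimal_def allowable_switch_clpp)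
  from seq_eqD[OF this, of "c * (\<epsilon> / 2)"]
  obtain N where N: "\<forall>m>N. \<bar>crn_seq a m * crn_seq x m\<bar> < c * (\<epsilon> / 2)"
    using \<open>\<epsilon> > 0\<close> \<open>c > 0\<close> by auto
  obtain N' where N': "\<forall>m>N'. \<forall>n>N'. \<bar>crn_seq v m - crn_seq x n\<bar> < \<epsilon> / 2"
    using seq_eqD[OF v, of "\<epsilon> / 2"] \<open>\<epsilon> > 0\<close> by auto
  have "\<bar>crn_seq v n\<bar> < \<epsilon>" if "n > max t (max N N')" for n
  proof -
    have "c * \<bar>crn_seq x n\<bar> < c * (\<epsilon> / 2)"
      using N a[of n] that \<open>c > 0\<close> by (auto simp: abs_mult)
    then have "\<bar>crn_seq x n\<bar> < \<epsilon> / 2"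
      using \<open>c > 0\<close> by simp
    moreover have "\<bar>crn_seq v n - crn_seq x n\<bar> < \<epsilon> / 2"
      using N' that by auto
    ultimately show ?thesis by linarith
  qed
  then show ?thesis by blast
qed

section \<open>The diagonal argument\<close>

text \<open>The code of \<open>F\<close> is the only varying part of the problem's code. Each
  \<open>Suc (pair _ _)\<close> is a cons cell of \<open>list_encode\<close>.\<close>

lemma computable_switch_clpp_encode:
  obtains code where "computable code"
    and "\<And>F. clpp_encode (switch_clpp (F, R)) = code (algorithm_encode F)"
proof
  let ?r = "\<lambda>q. crn_encode (rat_crn q)"
  let ?c = "\<lambda>e t b. pair (Suc (pair e 0)) (pair t (?r b))"
  let ?code = "\<lambda>e. pair 0 (pair (Suc (pair (?r 1) 0))
    (Suc (pair (?c (pair e (algorithm_encode R)) 0 0)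
      (Suc (pair (?c (?r 1) 2 0) (Suc (pair (?c (?r 1) 1 1) 0)))))))"
  show "computable ?code"
    by (intro computable_intros)
  show "clpp_encode (switch_clpp (F, R)) = ?code (algorithm_encode F)" for F
    by (simp add: clpp_encode_def switch_clpp_def constraint_encode_def crns_encode_def
        crn_encode_def)
qed

section \<open>Codes of rationals and bounds on their values\<close>

lemma rat_encode_0: "rat_encode 0 = pair 0 1"
  by (simp add: rat_encode_def int_encode_def sum_encode_def)

text \<open>The fraction is already reduced, and 2 is \<open>int_encode 1\<close>.\<close>

lemma rat_encode_inverse:
  assumes "t > 0"
  shows "rat_encode (1 / of_nat t) = pair 2 t"
proof -
  have "quotient_of (Fract 1 (int t)) = (1, int t)"
    using assms by (intro quotient_of_Fract[THEN trans]) (simp add: normalize_def)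
  then show ?thesis
    by (simp add: rat_encode_def int_encode_def sum_encode_def Fract_of_int_quotient)
qed

text \<open>A positive reduced fraction has numerator at least 1. The denominator thus supplies a
  modulus without any division.\<close>

lemma inverse_denominator_le:
  assumes "\<epsilon> > 0"
  shows "1 / of_nat (right (rat_encode \<epsilon>)) \<le> \<epsilon>" and "right (rat_encode \<epsilon>) > 0"
proof -
  obtain p q where pq: "quotient_of \<epsilon> = (p, q)" by (cases "quotient_of \<epsilon>")
  have "q > 0" and e: "\<epsilon> = of_int p / of_int q"
    using quotient_of_denom_pos[OF pq] quotient_of_div[OF pq] by auto
  with assms have "p \<ge> 1"
    by (simp add: zero_less_divide_iff)
  have r: "right (rat_encode \<epsilon>) = nat q"
    by (simp add: rat_encode_def pq)
  show "1 / of_nat (right (rat_encode \<epsilon>)) \<le> \<epsilon>"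
    using \<open>q > 0\<close> \<open>p \<ge> 1\<close> unfolding r by (simp add: e divide_right_mono)
  show "right (rat_encode \<epsilon>) > 0" using \<open>q > 0\<close> r by simp
qed

text \<open>
  \<^const>\<open>int_encode\<close> maps \<open>p \<ge> 0\<close> to \<open>2 p\<close> and \<open>p < 0\<close> to \<open>-2 p - 1\<close>, so comparing it with the
  denominator compares the absolute value of the fraction with about \<open>1/2\<close>.
\<close>

lemma rat_encode_above_half:
  assumes "q \<ge> 3 / 4"
  shows "right (rat_encode q) < left (rat_encode q)"
proof -
  obtain a b where ab: "quotient_of q = (a, b)" by (cases "quotient_of q")
  have b: "b > 0" and q: "q = of_int a / of_int b"
    using quotient_of_denom_pos[OF ab] quotient_of_div[OF ab] by auto
  have "3 * of_int b \<le> (4 * of_int a :: rat)"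
    using assms b by (simp add: q field_simps)
  then have "3 * b \<le> 4 * a" by linarith
  with b show ?thesis
    by (simp add: rat_encode_def ab int_encode_def sum_encode_def)
qed

lemma rat_encode_below_half:
  assumes "\<bar>q\<bar> \<le> 1 / 4"
  shows "\<not> right (rat_encode q) < left (rat_encode q)"
proof -
  obtain a b where ab: "quotient_of q = (a, b)" by (cases "quotient_of q")
  have b: "b > 0" and q: "q = of_int a / of_int b"
    using quotient_of_denom_pos[OF ab] quotient_of_div[OF ab] by auto
  have "4 * \<bar>of_int a\<bar> \<le> (of_int b :: rat)"
    using assms b by (simp add: q field_simps)
  then have "4 * \<bar>a\<bar> \<le> b" by linarith
  with b show ?thesis
    by (auto simp: rat_encode_def ab int_encode_def sum_encode_def)
qed

section \<open>First hits and the sequence they define\<close>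

fun first_hit :: "(nat \<Rightarrow> bool) \<Rightarrow> nat \<Rightarrow> nat" where
  "first_hit P 0 = 0"
| "first_hit P (Suc n) =
    (if first_hit P n = 0 then if P n then Suc n else 0 else first_hit P n)"

lemma first_hit_stable: "first_hit P m \<noteq> 0 \<Longrightarrow> m \<le> n \<Longrightarrow> first_hit P n = first_hit P m"
  by (induction n) (auto simp: le_Suc_eq split: if_splits)

lemma first_hit_eq_0: "(\<And>n. \<not> P n) \<Longrightarrow> first_hit P n = 0"
  by (induction n) auto

text \<open>A recorded value is itself an index at which the hit is already visible. Were it at most
  \<open>m\<close>, stability would make the hit visible at \<open>m\<close>.\<close>

lemma first_hit_new:
  assumes "first_hit P m = 0" and "first_hit P n \<noteq> 0"
  shows "first_hit P n > m"
proof (rule ccontr)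
  assume "\<not> first_hit P n > m"
  moreover have "first_hit P (first_hit P n) = first_hit P n"
    by (induction n) auto
  ultimately show False
    using assms first_hit_stable[of P "first_hit P n" m] by simp
qed

lemma computable_first_hit:
  assumes "decidable (\<lambda>z. P (left z) (right z))"
  shows "computable (\<lambda>z. first_hit (P (left z)) (right z))"
proof -
  let ?g = "\<lambda>e m r. if r = 0 then if P e m then Suc m else 0 else r"
  have "decidable (\<lambda>z. P (left z) (left (right z)))"
    using computable_comp[OF assms[unfolded decidable_def],
        of "\<lambda>z. pair (left z) (left (right z))"]
    by (simp add: decidable_def computable_intros)
  then have "computable (\<lambda>z. rec_nat 0 (?g (left z)) (right z))"
    by (intro computable_rec[where f = "\<lambda>_. 0" and g = ?g and a = left and n = right]
        computable_intros)
  moreover have "rec_nat 0 (?g e) n = first_hit (P e) n" for e n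
    by (induction n) auto
  ultimately show ?thesis by simp
qed

text \<open>A hit at \<open>n\<close> is recorded as \<open>Suc n\<close>, which leaves 0 free to
  mean that no hit has occurred and keeps the denominator positive.\<close>

definition hit_rat :: "(nat \<Rightarrow> bool) \<Rightarrow> nat \<Rightarrow> rat" where
  "hit_rat P n = (if first_hit P n = 0 then 0 else 1 / of_nat (first_hit P n))"

lemma rat_encode_hit_rat:
  "rat_encode (hit_rat P n) =
    (if first_hit P n = 0 then pair 0 1 else pair 2 (first_hit P n))"
  by (simp add: hit_rat_def rat_encode_0 rat_encode_inverse)

text \<open>
  After \<open>1/\<epsilon>\<close> steps, a hit changes the sequence by less than \<open>\<epsilon>\<close>; the denominator of \<open>\<epsilon>\<close>, which
  \<^const>\<open>Snd\<close> extracts, is at least \<open>1/\<epsilon>\<close>.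
\<close>

lemma is_crn_hit_rat:
  assumes "\<And>n. computes F n (rat_encode (hit_rat P n))"
  shows "is_crn (F, Snd)"
proof -
  have seq: "crn_seq (F, Snd) n = hit_rat P n" for n
    using assms by (intro crn_seq_eqI) simp
  have "\<bar>hit_rat P m - hit_rat P n\<bar> < \<epsilon>"
    if "\<epsilon> > 0" and "m > right (rat_encode \<epsilon>)" and "n > right (rat_encode \<epsilon>)" for \<epsilon> m n
  proof -
    define N where "N = right (rat_encode \<epsilon>)"
    have N: "N > 0" "1 / of_nat N \<le> \<epsilon>" "N \<le> m" "N \<le> n"
      using inverse_denominator_le[OF that(1)] that(2,3) by (auto simp: N_def)
    \<comment> \<open>If a hit is visible at \<open>N\<close>, both terms agree; otherwise both lie
      in the interval from 0 to below \<epsilon>.\<close>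
    show ?thesis
    proof (cases "first_hit P N = 0")
      case False
      then show ?thesis
        using first_hit_stable[OF False N(3)] first_hit_stable[OF False N(4)] \<open>\<epsilon> > 0\<close>
        by (simp add: hit_rat_def)
    next
      case True
      have "0 \<le> hit_rat P k \<and> hit_rat P k < \<epsilon>" for k
      proof (cases "first_hit P k = 0")
        case False
        have "1 / of_nat (first_hit P k) < (1 / of_nat N :: rat)"
          using first_hit_new[OF True False] N(1) by (simp add: frac_less2)
        also have "\<dots> \<le> \<epsilon>" by (rule N)
        finally show ?thesis using False by (simp add: hit_rat_def)
      qed (use \<open>\<epsilon> > 0\<close> in \<open>simp add: hit_rat_def\<close>)
      from this[of m] this[of n] show ?thesis by linarith
    qed
  qed
  then show ?thesis
    unfolding is_crn_def seq using assms computes_Snd by (metis fst_conv snd_conv)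
qed

section \<open>Halting runs and approximation of a computed real\<close>

definition halted :: "nat \<Rightarrow> bool" where
  "halted s \<longleftrightarrow> right s = pair (pair 12 0) 0"

text \<open>Tag 12 carries no instruction, so \<open>step\<close> fixes a halted state. All halted
  states of one run therefore coincide, and the output does not depend on when it is
  inspected.\<close>

lemma halted_unique:
  assumes "halted ((step ^^ m) s)" and "halted ((step ^^ n) s)"
  shows "(step ^^ m) s = (step ^^ n) s"
proof -
  have fix_step: "step s = s" if "halted s" for s
    using that by (simp add: halted_def step_def)
  have "(step ^^ k) s = s" if "halted s" for k s
    by (induction k) (simp_all add: fix_step that)
  then have *: "(step ^^ (k + j)) s = (step ^^ j) s" if "halted ((step ^^ j) s)" for j k
    using that by (simp add: funpow_add)
  show ?thesis
    using *[OF assms(1), of "n - m"] *[OF assms(2), of "m - n"]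
    by (cases m n rule: le_cases) auto
qed

lemma runs_constant: "runs (algorithm_encode (const_algorithm c)) x c"
  by (intro computes_runs computes_constant)

lemma runs_left: "runs (pair 2 0) x (left x)"
  using computes_runs[OF computes_Fst] by simp

lemma runs_right: "runs (pair 3 0) x (right x)"
  using computes_runs[OF computes_Snd] by simp

lemma runs_Suc: "runs (pair 1 0) x (Suc x)"
  using computes_runs[OF computes_Succ] by simp

text \<open>The real arrives as data, so its two algorithms are run through the apply instruction
  with tag 11: first the modulus on \<epsilon>, then the sequence at the resulting index.\<close>

lemma approximation_instruction:
  obtains c where "\<And>v N. is_crn v \<Longrightarrow> computes (snd v) (rat_encode \<epsilon>) N \<Longrightarrow>
    runs c (crn_encode v) (rat_encode (crn_seq v (Suc N)))"
proof -
  let ?r = "pair 4 (pair (pair 3 0) (algorithm_encode (const_algorithm (rat_encode \<epsilon>))))"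
  \<comment> \<open>The modulus guarantees closeness only strictly beyond \<open>N\<close>, hence
    the successor.\<close>
  let ?n = "pair 5 (pair (pair 1 0) (pair 5 (pair (pair 11 0) ?r)))"
  let ?c = "pair 5 (pair (pair 11 0) (pair 4 (pair (pair 2 0) ?n)))"
  have "runs ?c (crn_encode v) (rat_encode (crn_seq v (Suc N)))"
    if v: "is_crn v" and N: "computes (snd v) (rat_encode \<epsilon>) N" for v N
  proof -
    have "runs ?n (crn_encode v) (Suc N)"
      using runs_Comp[OF runs_Comp[OF runs_Tup[OF runs_right runs_constant]] runs_Suc]
        runs_apply[OF computes_runs[OF N]] by (simp add: crn_encode_def)
    from runs_Tup[OF runs_left this]
    show ?thesis
      using runs_Comp runs_apply[OF computes_runs[OF is_crn_computes[OF v, of "Suc N"]]]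
      by (simp add: crn_encode_def)
  qed
  with that show ?thesis by blast
qed

text \<open>The counterexample depends on \<open>A\<close>. With \<open>A\<close> arbitrary, the
  result also applies to algorithms obtained by post-processing another one.\<close>

lemma no_extremal_value_algorithm:
  obtains a where "is_crn a"
    and "\<not> (\<exists>v. computes A (clpp_encode (switch_clpp a)) (crn_encode v) \<and>
      extremal_value (switch_clpp a) v)"
proof -
  obtain code where code: "computable code"
    "\<And>F. clpp_encode (switch_clpp (F, Snd)) = code (algorithm_encode F)"
    using computable_switch_clpp_encode by blast
  obtain c where c: "\<And>v N. is_crn v \<Longrightarrow> computes (snd v) (rat_encode (1 / 4)) N \<Longrightarrow>
      runs c (crn_encode v) (rat_encode (crn_seq v (Suc N)))"
    using approximation_instruction by blast
  \<comment> \<open>The machine is loaded with the code of the problem, the composition of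
    \<open>A\<close> with the approximation, and the halting marker at the bottom.\<close>
  define start where
    "start e = pair (code e) (pair (pair 5 (pair c (algorithm_encode A))) (pair (pair 12 0) 0))" for e
  \<comment> \<open>The comparison of denominator and coded numerator tests whether the output lies
    above about 1/2.\<close>
  define P where "P e n \<longleftrightarrow> halted ((step ^^ n) (start e)) \<and>
      right (left ((step ^^ n) (start e))) < left (left ((step ^^ n) (start e)))" for e n
  have start: "computable start"
    unfolding start_def by (intro computable_intros code)
  then have "computable (\<lambda>z. (step ^^ right z) (start (left z)))"
    by (intro computable_funpow computable_step computable_comp[OF start] computable_intros)
  then have "decidable (\<lambda>z. P (left z) (right z))"
    unfolding P_def halted_def by (intro computable_intros)
  then have "computable (\<lambda>z. rat_encode (hit_rat (P (left z)) (right z)))"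
    unfolding rat_encode_hit_rat by (intro computable_intros computable_first_hit)
  from recursion_theorem[OF this]
  obtain F where F: "\<And>n. computes F n (rat_encode (hit_rat (P (algorithm_encode F)) n))"
    by (metis fst_conv prod_encode_inverse snd_conv)
  let ?a = "(F, Snd)" and ?P = "P (algorithm_encode F)" and ?s = "start (algorithm_encode F)"
  have a: "crn_seq ?a n = hit_rat ?P n" for n
    using F by (intro crn_seq_eqI) simp
  have False
    if A: "computes A (clpp_encode (switch_clpp ?a)) (crn_encode v)"
      and ext: "extremal_value (switch_clpp ?a) v" for v
  proof -
    have v: "is_crn v" using ext by (simp add: extremal_value_def)
    obtain N where N: "computes (snd v) (rat_encode (1 / 4)) N"
      "\<And>m n. m > N \<Longrightarrow> n > N \<Longrightarrow> \<bar>crn_seq v m - crn_seq v n\<bar> < 1 / 4"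
      using is_crn_modulus[OF v, of "1 / 4"] by auto
    define q where "q = crn_seq v (Suc N)"
    have "runs (pair 5 (pair c (algorithm_encode A))) (code (algorithm_encode F)) (rat_encode q)"
      using runs_Comp[OF computes_runs[OF A] c[OF v N(1)]] by (simp add: code(2) q_def)
    then obtain l where l: "(step ^^ l) ?s = pair (rat_encode q) (pair (pair 12 0) 0)"
      unfolding runs_def reaches_def start_def by blast
    then have halt: "halted ((step ^^ l) ?s)" by (simp add: halted_def)
    \<comment> \<open>Since the halted state is unique, the comparison always concerns the same
      rational \<open>q\<close>.\<close>
    have P: "?P n \<longleftrightarrow> halted ((step ^^ n) ?s) \<and> right (rat_encode q) < left (rat_encode q)" for n
    proof (cases "halted ((step ^^ n) ?s)")
      case True
      then have "(step ^^ n) ?s = pair (rat_encode q) (pair (pair 12 0) 0)"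
        using halted_unique[OF halt] l by simp
      with True show ?thesis by (simp add: P_def)
    qed (simp add: P_def)
    show False
    proof (cases "right (rat_encode q) < left (rat_encode q)")
      case True
      \<comment> \<open>The large answer triggers a hit; the coefficient becomes a positive
        constant, and the true value is 0.\<close>
      then have "?P l" using P halt by blast
      then have "first_hit ?P (Suc l) \<noteq> 0" by simp
      then obtain t where t: "first_hit ?P (Suc l) = t" "t > 0" by auto
      have "crn_seq ?a n = 1 / of_nat t" if "n \<ge> Suc l" for n
        using first_hit_stable[OF \<open>first_hit ?P (Suc l) \<noteq> 0\<close> that] t by (simp add: a hit_rat_def)
      moreover have "1 / of_nat t > (0 :: rat)" using t by simp
      ultimately have small: "\<exists>M. \<forall>n>M. \<bar>crn_seq v n\<bar> < \<epsilon>" if "\<epsilon> > 0" for \<epsilon>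
        using extremal_value_switch_clpp_pos ext that by blast
      \<comment> \<open>The terms of \<open>v\<close> tend to 0, while \<open>q\<close> is within
        1/4 of all terms beyond \<open>N\<close>.\<close>
      have "\<bar>q\<bar> \<le> 1 / 4"
      proof (rule field_le_epsilon)
        fix \<epsilon> :: rat
        assume "\<epsilon> > 0"
        from small[OF this] obtain M where "\<forall>n>M. \<bar>crn_seq v n\<bar> < \<epsilon>" by blast
        then have "\<bar>crn_seq v (Suc (max M N))\<bar> < \<epsilon>" by simp
        moreover have "\<bar>crn_seq v (Suc (max M N)) - q\<bar> < 1 / 4"
          unfolding q_def by (rule N(2)) simp_all
        ultimately show "\<bar>q\<bar> \<le> 1 / 4 + \<epsilon>" by linarith
      qed
      with rat_encode_below_half True show False by blast
    next
      case False
      \<comment> \<open>The small answer never triggers a hit, so the coefficient is identically 0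
        and the true value is at least 1, which keeps \<open>q\<close> at or above 3/4.\<close>
      have "crn_seq ?a n = 0" for n
        using P False by (simp add: a hit_rat_def first_hit_eq_0)
      then have large: "\<exists>M. \<forall>n>M. crn_seq v n > 1 - \<epsilon>" if "\<epsilon> > 0" for \<epsilon>
        using extremal_value_switch_clpp_0 ext that by blast
      have "3 / 4 \<le> q"
      proof (rule field_le_epsilon)
        fix \<epsilon> :: rat
        assume "\<epsilon> > 0"
        from large[OF this] obtain M where "\<forall>n>M. crn_seq v n > 1 - \<epsilon>" by blast
        then have "crn_seq v (Suc (max M N)) > 1 - \<epsilon>" by simp
        moreover have "\<bar>crn_seq v (Suc (max M N)) - q\<bar> < 1 / 4"
          unfolding q_def by (rule N(2)) simp_all
        ultimately show "3 / 4 \<le> q + \<epsilon>" by linarith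
      qed
      with rat_encode_above_half False show False by blast
    qed
  qed
  moreover have "is_crn ?a" using F by (rule is_crn_hit_rat)
  ultimately show ?thesis using that by blast
qed

text \<open>There is one variable with cost coefficient 1, so the coordinate of an optimal plan is
  the extremal value.\<close>

lemma optimal_switch_clpp_extremal_value:
  assumes "optimal (switch_clpp a) y"
  obtains x where "y = [x]" and "extremal_value (switch_clpp a) x"
proof -
  obtain x where x: "y = [x]" "is_crn x"
    using assms by (auto simp: optimal_def allowable_switch_clpp)
  \<comment> \<open>Reflexivity is witnessed by the modulus of \<open>x\<close>.\<close>
  have "seq_eq (crn_seq x) (crn_seq x)"
    unfolding seq_eq_def using x(2) unfolding is_crn_def by blast
  then have "seq_eq (crn_seq x) (linear_form (cost (switch_clpp a)) y)"
    by (simp add: x switch_clpp_def linear_form_singleton)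
  then show ?thesis
    using that x assms unfolding extremal_value_def by blast
qed

theorem theorem3:
  shows "\<not> (\<exists>A. \<forall>P. is_clpp P \<and> nonempty_clpp P \<and> bounded_clpp P \<longrightarrow>
             (\<exists>x. computes A (clpp_encode P) (crns_encode x) \<and> optimal P x))
       \<and> \<not> (\<exists>A. \<forall>P. is_clpp P \<and> nonempty_clpp P \<and> bounded_clpp P \<longrightarrow>
             (\<exists>v. computes A (clpp_encode P) (crn_encode v) \<and> extremal_value P v))"
proof -
  have admissible: "is_clpp (switch_clpp a) \<and> nonempty_clpp (switch_clpp a) \<and> bounded_clpp (switch_clpp a)"
    if "is_crn a" for a
    using that is_clpp_switch_clpp nonempty_switch_clpp bounded_switch_clpp by blast
  have False
    if A: "\<forall>P. is_clpp P \<and> nonempty_clpp P \<and> bounded_clpp P \<longrightarrow>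
      (\<exists>x. computes A (clpp_encode P) (crns_encode x) \<and> optimal P x)" for A
  proof -
    \<comment> \<open>\<open>list_encode\<close> codes a cons cell as the successor of a pair, so
      this function extracts the head of a plan and reduces (1) to (2).\<close>
    have "computable (\<lambda>z. left (z - 1))" by (intro computable_intros)
    then obtain head where head: "\<And>z. computes head z (left (z - 1))"
      unfolding computable_def by blast
    obtain a where "is_crn a" and
      a: "\<not> (\<exists>v. computes (Comp head A) (clpp_encode (switch_clpp a)) (crn_encode v) \<and>
        extremal_value (switch_clpp a) v)"
      by (rule no_extremal_value_algorithm)
    then obtain y where y: "computes A (clpp_encode (switch_clpp a)) (crns_encode y)"
      "optimal (switch_clpp a) y"
      using A admissible by blast
    obtain x where x: "y = [x]" "extremal_value (switch_clpp a) x"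
      using y(2) by (rule optimal_switch_clpp_extremal_value)
    have "computes (Comp head A) (clpp_encode (switch_clpp a)) (crn_encode x)"
      using computes_Comp[OF y(1) head] by (simp add: x(1) crns_encode_def)
    with a x(2) show False by blast
  qed
  moreover have False
    if "\<forall>P. is_clpp P \<and> nonempty_clpp P \<and> bounded_clpp P \<longrightarrow>
      (\<exists>v. computes A (clpp_encode P) (crn_encode v) \<and> extremal_value P v)" for A
    using no_extremal_value_algorithm[of A] that admissible by metis
  ultimately show ?thesis by blast
qed

end
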